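(* Let $\mathcal{P}$ be a fixed hyper-prior and $\delta>0$. Then with probability at least $1-\delta$ over the sampling of $S_1,\dots,S_n$, simultaneously for all hyper-posteriors $\mathcal{Q}$ and all posteriors $Q_1,\dots,Q_n$, $$\mathrm{kl}\big(\widehat{\mathcal{R}}^{S}\,\big|\,\mathcal{R}^{S}\big)\;\le\;\frac{\mathrm{KL}(\mathfrak{Q}\|\mathfrak{P})+\log\frac{2\sqrt M}{\delta}}{M},$$ where $M=\sum_{i=1}^n m_i$, $\mathcal{R}^S=\sum_{i=1}^n\frac{m_i}{M}\mathcal{R}_i(Q_i)$ and $\widehat{\mathcal{R}}^S=\sum_{i=1}^n\frac{m_i}{M}\widehat{\mathcal{R}}_i(Q_i)=\frac1M\sum_{i=1}^n\sum_{j=1}^{m_i}\ell_i(Q_i,z_{ij})$.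
   Context: Multi-task setting: $n$ tasks; task $i$ has an unknown distribution $D_i$ on $\mathcal{Z}$, a loss $\ell_i:\mathcal{F}\times\mathcal{Z}\to[0,1]$, and a training set $S_i=(z_{i1},\dots,z_{im_i})$ of $m_i\ge1$ i.i.d. samples from $D_i$, the $S_i$ mutually independent. $\mathcal{M}(\mathcal{F})$ is the set of probability distributions on $\mathcal{F}$. For $Q\in\mathcal{M}(\mathcal{F})$: $\ell_i(Q,z)=\mathbb{E}_{f\sim Q}\ell_i(f,z)$, $\mathcal{R}_i(Q)=\mathbb{E}_{z\sim D_i}\ell_i(Q,z)$, $\widehat{\mathcal{R}}_i(Q)=\frac1{m_i}\sum_{j=1}^{m_i}\ell_i(Q,z_{ij})$. Hyper-prior $\mathcal{P}$ (data-independent) and hyper-posterior $\mathcal{Q}$ are distributions on $\mathcal{M}(\mathcal{F})$; posteriors $Q_i\in\mathcal{M}(\mathcal{F})$; $\mathcal{Q},Q_i$ may depend on the data. $\mathfrak{Q}=\mathcal{Q}\times Q_1\times\cdots\times Q_n$ on $\mathcal{M}(\mathcal{F})\times\mathcal{F}^n$; $\mathfrak{P}$ on the same space is generated by $P\sim\mathcal{P}$, then $f_1,\dots,f_n$ i.i.d. $\sim P$. $\mathrm{KL}$ is the Kullback–Leibler divergence, and $\mathrm{kl}(q|p)=q\log\frac qp+(1-q)\log\frac{1-q}{1-p}$ (convention $0\log0=0$). *)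

theory Defs
  imports "HOL-Probability.Probability"
begin

definition kl_bin :: "real \<Rightarrow> real \<Rightarrow> ereal" where
  "kl_bin q p =
     (if q = 0 then 0 else if p = 0 then \<infinity> else ereal (q * ln (q / p))) +
     (if q = 1 then 0 else if p = 1 then \<infinity> else ereal ((1 - q) * ln ((1 - q) / (1 - p))))"

definition KLdiv :: "'a measure \<Rightarrow> 'a measure \<Rightarrow> ereal" where
  "KLdiv Q P =
     (if absolutely_continuous P Q \<and> integrable Q (entropy_density (exp 1) P Q)
      then ereal (KL_divergence (exp 1) P Q) else \<infinity>)"

definition frakP :: "'f measure \<Rightarrow> nat \<Rightarrow> 'f measure measure \<Rightarrow> ('f measure \<times> (nat \<Rightarrow> 'f)) measure" where
  "frakP F n HP = HP \<bind> (\<lambda>P. distr (PiM {..<n} (\<lambda>_. P))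
       (prob_algebra F \<Otimes>\<^sub>M PiM {..<n} (\<lambda>_. F)) (\<lambda>fs. (P, fs)))"

definition frakQ :: "nat \<Rightarrow> 'f measure measure \<Rightarrow> (nat \<Rightarrow> 'f measure) \<Rightarrow> ('f measure \<times> (nat \<Rightarrow> 'f)) measure" where
  "frakQ n HQ Q = HQ \<Otimes>\<^sub>M PiM {..<n} Q"

definition loss_Q :: "('f \<Rightarrow> 'z \<Rightarrow> real) \<Rightarrow> 'f measure \<Rightarrow> 'z \<Rightarrow> real" where
  "loss_Q l Q z = (\<integral>f. l f z \<partial>Q)"

definition risk :: "('f \<Rightarrow> 'z \<Rightarrow> real) \<Rightarrow> 'z measure \<Rightarrow> 'f measure \<Rightarrow> real" where
  "risk l D Q = (\<integral>z. loss_Q l Q z \<partial>D)"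

definition emp_risk :: "('f \<Rightarrow> 'z \<Rightarrow> real) \<Rightarrow> nat \<Rightarrow> (nat \<Rightarrow> 'z) \<Rightarrow> 'f measure \<Rightarrow> real" where
  "emp_risk l m s Q = (1 / real m) * (\<Sum>j<m. loss_Q l Q (s j))"

definition sample_dist :: "nat \<Rightarrow> (nat \<Rightarrow> nat) \<Rightarrow> (nat \<Rightarrow> 'z measure) \<Rightarrow> (nat \<Rightarrow> nat \<Rightarrow> 'z) measure" where
  "sample_dist n m D = PiM {..<n} (\<lambda>i. PiM {..<m i} (\<lambda>_. D i))"

end

theory Submission
  imports Defs "HOL-Real_Asymp.Real_Asymp"
begin

text \<open>
  Write \<open>q(f, S)\<close> and \<open>p(f)\<close> for the weighted empirical and true risk of a tuple \<open>f\<close> of predictors.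
  The binary divergence satisfies
  \<open>kl(q|p) = sup {q ln a + (1 - q) ln b - ln (p a + (1 - p) b) | a, b > 0}\<close>, and each expression on
  the right is jointly convex in \<open>(q, p)\<close>. Jensen's inequality and the Donsker-Varadhan inequality
  then reduce the claim to \<open>E\<^sub>P exp (M kl(q|p)) \<le> 2 \<surd>M / \<delta>\<close> for the prior \<open>P\<close>, an event that does not
  involve the posterior; by Markov's inequality and Fubini's theorem it suffices that
  \<open>E\<^sub>S exp (M kl(q|p)) \<le> 2 \<surd>M\<close> for each fixed \<open>f\<close>.

  The samples are not identically distributed. Instead of comparing with the binomial distribution,
  \<open>exp (M kl(q|p))\<close> is bounded by \<open>2 \<surd>M\<close> times the Krichevsky-Trofimov mixture of the likelihood
  ratios \<open>(t/p)\<^sup>k ((1-t)/(1-p))\<^sup>M\<^sup>-\<^sup>k\<close>, \<open>k = M q\<close>, over \<open>t\<close> with the Beta(1/2, 1/2) distribution. Each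
  ratio has mean at most 1. The mixture bound is needed for real \<open>k\<close>; it follows from the monotonicity
  of \<open>Digamma (x + 1/2) - ln x\<close>.
\<close>

subsection \<open>The Krichevsky-Trofimov bound for real arguments\<close>

text \<open>The trigamma series is compared term by term with a telescoping one:
  \<open>(y + 1/2)^2\<close> exceeds \<open>y * (y + 1)\<close>, and
  \<open>1 / (y * (y + 1)) = 1/y - 1/(y + 1)\<close>.\<close>

lemma trigamma_shift_half_le:
  fixes x :: real
  assumes "x > 0"
  shows "Polygamma 1 (x + 1/2) \<le> 1 / x"
proof -
  have lim: "(\<lambda>k. inverse (x + real k)) \<longlonglongrightarrow> 0"
    by real_asymp
  from telescope_sums'[OF this]
  have tel: "(\<lambda>k. inverse (x + real k) - inverse (x + real (Suc k))) sums (1 / x)"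
    by (simp add: inverse_eq_divide)
  have "(\<Sum>k. inverse ((x + 1/2 + real k) ^ 2)) \<le> (\<Sum>k. inverse (x + real k) - inverse (x + real (Suc k)))"
  proof (rule suminf_le)
    fix k
    define y where "y = x + real k"
    have y: "y > 0" using assms by (simp add: y_def add_pos_nonneg)
    have "inverse ((y + 1/2) ^ 2) \<le> inverse (y * (y + 1))"
      using y by (intro le_imp_inverse_le) (auto simp: power2_eq_square algebra_simps intro: add_pos_pos)
    also have "\<dots> = inverse y - inverse (y + 1)"
      using y by (simp add: field_simps)
    finally show "inverse ((x + 1/2 + real k) ^ 2) \<le> inverse (x + real k) - inverse (x + real (Suc k))"
      by (simp add: y_def algebra_simps)
  next
    show "summable (\<lambda>k. inverse ((x + 1/2 + real k) ^ 2))"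
      using assms by (intro Polygamma_converges') auto
  qed (use tel in \<open>simp add: sums_iff\<close>)
  also have "\<dots> = 1 / x" using tel by (simp add: sums_iff)
  finally show ?thesis by (simp add: Polygamma_def numeral_2_eq_2)
qed

lemma digamma_shift_half_minus_ln_antimono:
  fixes x y :: real
  assumes "0 < x" "x \<le> y"
  shows "Digamma (y + 1/2) - ln y \<le> Digamma (x + 1/2) - ln x"
proof (rule DERIV_nonpos_imp_nonincreasing[OF assms(2)])
  fix t assume "x \<le> t" "t \<le> y"
  then have t: "t > 0" using assms by simp
  then have "t + 1/2 \<notin> \<int>\<^sub>\<le>\<^sub>0" by (auto elim!: nonpos_Ints_cases)
  then have "((\<lambda>t. Digamma (t + 1/2) - ln t) has_real_derivative Polygamma 1 (t + 1/2) - 1 / t) (at t)"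
    using t by (auto intro!: derivative_eq_intros simp: inverse_eq_divide)
  then show "\<exists>D. ((\<lambda>t. Digamma (t + 1/2) - ln t) has_real_derivative D) (at t) \<and> D \<le> 0"
    using trigamma_shift_half_le[OF t] by auto
qed

text \<open>With \<open>ln 0 = 0\<close> the value at 0 agrees with the limit from the right. The
  monotonicity argument for the entropy starts at the endpoint 0, where the derivative does not
  exist.\<close>

lemma continuous_on_x_ln_x: "continuous_on {0..} (\<lambda>x::real. x * ln x)"
  unfolding continuous_on_eq_continuous_within
proof
  fix x :: real assume "x \<in> {0..}"
  show "continuous (at x within {0..}) (\<lambda>x. x * ln x)"
  proof (cases "x = 0")
    case True
    have "((\<lambda>x::real. x * ln x) \<longlongrightarrow> 0) (at_right 0)" by real_asymp
    moreover have "at 0 within {0..} = at_right (0::real)"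
      by (rule at_within_nhd[of _ UNIV]) auto
    ultimately show ?thesis using True by (simp add: continuous_within)
  next
    case False
    then show ?thesis using \<open>x \<in> {0..}\<close> by (auto intro!: continuous_intros)
  qed
qed

text \<open>Equality holds at \<open>M = 1\<close>. From \<open>m\<close> to \<open>m + 1\<close>
  the Beta value is multiplied by \<open>(m + 1/2) / (m + 1)\<close> and the bound by
  \<open>sqrt (m / (m + 1))\<close>, which is smaller because
  \<open>sqrt (m * (m + 1)) \<le> m + 1/2\<close>.\<close>

lemma Beta_half_lower_bound:
  assumes "M \<ge> 1"
  shows "pi / (2 * sqrt (real M)) \<le> Beta (1/2) (real M + 1/2)"
  using assms
proof (induction M rule: nat_induct_at_least)
  case base
  have "Gamma (3/2 :: real) = 1/2 * sqrt pi"
    using Gamma_plus1[of "1/2 :: real"] nonpos_Ints_nonpos[of "1/2 :: real"]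
    by (force simp: Gamma_one_half_real add.commute)
  then have "sqrt pi * (Gamma (3/2) * 2) = pi" by simp
  then show ?case
    by (simp add: Beta_def Gamma_one_half_real Gamma_numeral mult.assoc)
next
  case (Suc M)
  define m where "m = real M"
  have m: "m \<ge> 1" using Suc by (simp add: m_def)
  have *: "1/2 + (m + 1/2) = m + 1" by simp
  have "(m + 1) * Beta (1/2) (m + 1/2 + 1) = (m + 1/2) * Beta (1/2) (m + 1/2)"
    using Beta_plus1_right[where x = "1/2" and y = "m + 1/2"] nonpos_Ints_nonpos[of "m + 1/2"] m
    unfolding * by force
  then have eq: "Beta (1/2) (m + 1/2 + 1) = (m + 1/2) / (m + 1) * Beta (1/2) (m + 1/2)"
    using m by (simp add: field_simps)
  have "sqrt (m * (m + 1)) \<le> m + 1/2"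
    using m by (intro real_le_lsqrt) (auto simp: power2_eq_square algebra_simps)
  then have "sqrt m * sqrt (m + 1) * sqrt (m + 1) \<le> (m + 1/2) * sqrt (m + 1)"
    using m by (intro mult_right_mono) (auto simp: real_sqrt_mult)
  then have "sqrt m * (m + 1) \<le> (m + 1/2) * sqrt (m + 1)"
    using m by (simp add: mult.assoc)
  then have "1 / sqrt (m + 1) \<le> (m + 1/2) / ((m + 1) * sqrt m)"
    using m by (simp add: pos_divide_le_eq pos_le_divide_eq mult_ac)
  from mult_left_mono[OF this, of "pi / 2"]
  have "pi / (2 * sqrt (m + 1)) \<le> (m + 1/2) / (m + 1) * (pi / (2 * sqrt m))"
    by (simp add: mult_ac)
  also have "\<dots> \<le> (m + 1/2) / (m + 1) * Beta (1/2) (m + 1/2)"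
    using Suc m by (intro mult_left_mono) (auto simp: m_def)
  finally show ?case unfolding eq[symmetric] by (simp add: m_def add_ac)
qed

text \<open>The logarithm of the ratio of the mixture to the maximised likelihood is smallest at the
  endpoint \<open>k = 0\<close>. With \<open>d x = Digamma (x + 1/2) - ln x\<close>, its derivative
  at \<open>a\<close> is \<open>d a - d (M - a)\<close>, which is nonnegative since \<open>d\<close>
  is antitone and \<open>a \<le> M - a\<close>.\<close>

lemma ln_Gamma_half_entropy_le:
  fixes M k :: real
  assumes "0 \<le> k" "k \<le> M / 2" "M > 0"
  shows "ln_Gamma (1/2) + ln_Gamma (M + 1/2) - M * ln M
    \<le> ln_Gamma (k + 1/2) + ln_Gamma (M - k + 1/2) - k * ln k - (M - k) * ln (M - k)"
proof -
  define \<phi> where "\<phi> = (\<lambda>a. ln_Gamma (a + 1/2) + ln_Gamma (M - a + 1/2) - a * ln a - (M - a) * ln (M - a))"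
  have "\<phi> 0 \<le> \<phi> k"
  proof (rule DERIV_nonneg_imp_increasing_open[OF assms(1)])
    fix a assume a: "0 < a" "a < k"
    have "(\<phi> has_real_derivative (Digamma (a + 1/2) - ln a) - (Digamma (M - a + 1/2) - ln (M - a))) (at a)"
      unfolding \<phi>_def using a assms by (auto intro!: derivative_eq_intros)
    moreover have "Digamma (M - a + 1/2) - ln (M - a) \<le> Digamma (a + 1/2) - ln a"
      using a assms by (intro digamma_shift_half_minus_ln_antimono) auto
    ultimately show "\<exists>D. (\<phi> has_real_derivative D) (at a) \<and> 0 \<le> D" by force
  next
    have 1: "continuous_on {0..k} (\<lambda>a. a * ln a)"
      by (rule continuous_on_subset[OF continuous_on_x_ln_x]) auto
    have ln_Gamma: "continuous_on {0<..} (ln_Gamma :: real \<Rightarrow> real)"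
      by (intro continuous_at_imp_continuous_on ballI DERIV_isCont[OF has_field_derivative_ln_Gamma_real]) auto
    have 2: "continuous_on {0..k} (\<lambda>a. ln_Gamma (a + 1/2))"
      by (rule continuous_on_compose2[OF ln_Gamma]) (auto intro!: continuous_intros)
    have 3: "continuous_on {0..k} (\<lambda>a. ln_Gamma (M - a + 1/2))"
      by (rule continuous_on_compose2[OF ln_Gamma]) (use assms in \<open>auto intro!: continuous_intros\<close>)
    show "continuous_on {0..k} \<phi>"
      unfolding \<phi>_def by (intro continuous_intros 1 2 3) (use assms in auto)
  qed
  then show ?thesis by (simp add: \<phi>_def)
qed

text \<open>The left side is the maximum of \<open>t^k * (1 - t)^(M - k)\<close> over
  \<open>t\<close> in the unit interval; \<open>Beta (k + 1/2) (M - k + 1/2) / pi\<close> is its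
  mean under the arcsine law. The worst ratio occurs at the endpoints, where it is controlled by
  \<open>Beta_half_lower_bound\<close>.\<close>

lemma entropy_le_Beta_half:
  fixes k :: real
  assumes k: "0 \<le> k" "k \<le> real M" and M: "M \<ge> 1"
  shows "exp (k * ln (k / M) + (M - k) * ln ((M - k) / M)) \<le> 2 * sqrt M / pi * Beta (k + 1/2) (M - k + 1/2)"
proof -
  have M0: "real M > 0" using M by simp
  have key: "ln_Gamma (1/2) + ln_Gamma (M + 1/2) - M * ln M
      \<le> ln_Gamma (k + 1/2) + ln_Gamma (M - k + 1/2) - k * ln k - (M - k) * ln (M - k)"
  proof (cases "k \<le> real M / 2")
    case True
    then show ?thesis using ln_Gamma_half_entropy_le[of k "real M"] k M0 by simp
  next
    case False
    \<comment> \<open>The claim is symmetric under exchanging \<open>k\<close> and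
      \<open>M - k\<close>.\<close>
    then show ?thesis using ln_Gamma_half_entropy_le[of "M - k" "real M"] k M0 by simp
  qed
  have e: "x * ln (x / M) = x * ln x - x * ln M" if "x \<ge> 0" for x :: real
    using that M0 by (cases "x = 0") (auto simp: ln_div algebra_simps)
  have "k * ln (k / M) + (M - k) * ln ((M - k) / M) = k * ln k + (M - k) * ln (M - k) - M * ln M"
    using e[of k] e[of "M - k"] k by (simp add: algebra_simps)
  also have "\<dots> \<le> ln_Gamma (k + 1/2) + ln_Gamma (M - k + 1/2) - ln_Gamma (1/2) - ln_Gamma (M + 1/2)"
    using key by linarith
  finally have "exp (k * ln (k / M) + (M - k) * ln ((M - k) / M))
      \<le> exp (ln_Gamma (k + 1/2) + ln_Gamma (M - k + 1/2) - ln_Gamma (1/2) - ln_Gamma (M + 1/2))"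
    by simp
  also have "\<dots> = Gamma (k + 1/2) * Gamma (M - k + 1/2) / (Gamma (1/2) * Gamma (M + 1/2))"
    using k by (simp add: exp_diff exp_add Gamma_real_pos_exp)
  also have "\<dots> = Beta (k + 1/2) (M - k + 1/2) / Beta (1/2) (M + 1/2)"
    using Gamma_real_pos[of "1 + real M", THEN less_imp_neq] by (simp add: Beta_def add_ac)
  also have "\<dots> \<le> Beta (k + 1/2) (M - k + 1/2) / (pi / (2 * sqrt M))"
    using k M by (intro divide_left_mono Beta_half_lower_bound) (auto simp: Beta_def)
  finally show ?thesis by (simp add: field_simps)
qed

subsection \<open>Variational inequalities\<close>

lemma kl_bin_swap: "kl_bin (1 - q) (1 - p) = kl_bin q p"
  unfolding kl_bin_def by (simp add: add.commute)

text \<open>This is \<open>ln x \<le> x - 1\<close> at \<open>x = a * p / (q * c)\<close>. The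
  parameter \<open>c\<close> is free so that the bounds for the two summands of
  \<open>kl_bin\<close> can share one normaliser.\<close>

lemma kl_term_lower_bound:
  fixes p q a c :: real
  assumes "0 \<le> q" "0 \<le> p" "a > 0" "c > 0"
  shows "ereal (q * ln a + q - p * a / c - q * ln c)
    \<le> (if q = 0 then 0 else if p = 0 then \<infinity> else ereal (q * ln (q / p)))"
proof (cases "q = 0 \<or> p = 0")
  case True
  then show ?thesis using assms by auto
next
  case False
  then have pos: "q > 0" "p > 0" using assms by auto
  have "q * ln (a * p / (q * c)) \<le> q * (a * p / (q * c) - 1)"
    using pos assms by (intro mult_left_mono ln_le_minus_one) auto
  also have "\<dots> = p * a / c - q" using pos assms by (simp add: field_simps)
  finally show ?thesis
    using pos assms by (simp add: ln_div ln_mult algebra_simps)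
qed

lemma kl_bin_ge_variational:
  assumes q: "0 \<le> q" "q \<le> 1" and p: "0 \<le> p" "p \<le> 1" and ab: "a > 0" "b > 0"
  shows "ereal (q * ln a + (1 - q) * ln b - ln (p * a + (1 - p) * b)) \<le> kl_bin q p"
proof -
  define c where "c = p * a + (1 - p) * b"
  have c: "c > 0"
  proof (cases "p = 0")
    case False
    then show ?thesis using p ab by (auto simp: c_def intro!: add_pos_nonneg)
  qed (use ab in \<open>simp add: c_def\<close>)
  \<comment> \<open>With this choice of \<open>c\<close> the linear remainders of the two bounds,
    \<open>q + (1 - q)\<close> and \<open>p * a / c + (1 - p) * b / c\<close>, are both 1 and
    cancel.\<close>
  have "p * a / c + (1 - p) * b / c = 1"
    using c by (simp add: c_def add_divide_distrib[symmetric])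
  then have "ereal (q * ln a + (1 - q) * ln b - ln c) =
      ereal (q * ln a + q - p * a / c - q * ln c)
      + ereal ((1 - q) * ln b + (1 - q) - (1 - p) * b / c - (1 - q) * ln c)"
    by (simp add: algebra_simps)
  also have "\<dots> \<le> kl_bin q p"
    using kl_term_lower_bound[of q p a c] kl_term_lower_bound[of "1 - q" "1 - p" b c] q p ab c
    unfolding kl_bin_def by (intro add_mono) auto
  finally show ?thesis by (simp add: c_def)
qed

text \<open>Here the optimal \<open>a = q / p\<close> is zero or undefined, so it cannot be
  inserted. Either \<open>a\<close> tends to 0, or an extreme \<open>a\<close> contradicts the
  finite bound \<open>c\<close> because the divergence is infinite.\<close>

lemma kl_bin_le_variational_0:
  assumes q: "0 \<le> q" "q \<le> 1" and p: "0 \<le> p" "p \<le> 1" and "q = 0 \<or> p = 0"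
    and le: "\<And>a b. a > 0 \<Longrightarrow> b > 0 \<Longrightarrow> q * ln a + (1 - q) * ln b - ln (p * a + (1 - p) * b) \<le> c"
  shows "kl_bin q p \<le> ereal c"
proof (cases "q = 0")
  case True
  show ?thesis
  proof (cases "p = 1")
    case p1: True
    \<comment> \<open>For \<open>q = 0\<close>, \<open>p = 1\<close> the expression is
      \<open>- ln a\<close>, here \<open>c + 1\<close>.\<close>
    from le[of "exp (- c - 1)" 1] show ?thesis using True p1 by simp
  next
    case False
    then have p1: "p < 1" using p by simp
    have "((\<lambda>a. - ln (p * a + (1 - p) * 1)) \<longlongrightarrow> - ln (p * 0 + (1 - p) * 1)) (at_right 0)"
      using p1 by (intro tendsto_intros) auto
    moreover have "\<forall>\<^sub>F a in at_right 0. - ln (p * a + (1 - p) * 1) \<le> c"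
      using le[of _ 1] True by (auto simp: eventually_at_filter)
    ultimately have "- ln (1 - p) \<le> c"
      using tendsto_upperbound[of _ _ "at_right (0::real)"] by fastforce
    then show ?thesis using True p1 by (simp add: kl_bin_def ln_div)
  qed
next
  case False
  then have p0: "p = 0" and q0: "q > 0" using assms by auto
  \<comment> \<open>For \<open>p = 0\<close> and \<open>b = 1\<close> the expression is
    \<open>q * ln a\<close>, here \<open>\<bar>c\<bar> + 1\<close>.\<close>
  from le[of "exp ((\<bar>c\<bar> + 1) / q)" 1] show ?thesis using p0 q0 by auto
qed

lemma kl_bin_le_variational:
  assumes q: "0 \<le> q" "q \<le> 1" and p: "0 \<le> p" "p \<le> 1"
    and le: "\<And>a b. a > 0 \<Longrightarrow> b > 0 \<Longrightarrow> q * ln a + (1 - q) * ln b - ln (p * a + (1 - p) * b) \<le> c"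
  shows "kl_bin q p \<le> ereal c"
proof -
  consider "q = 0 \<or> p = 0" | "q = 1 \<or> p = 1" | "q \<noteq> 0" "q \<noteq> 1" "p \<noteq> 0" "p \<noteq> 1" by blast
  then show ?thesis
  proof cases
    case 1
    then show ?thesis using assms by (intro kl_bin_le_variational_0) auto
  next
    case 2
    have "kl_bin (1 - q) (1 - p) \<le> ereal c"
    proof (rule kl_bin_le_variational_0)
      fix a b :: real assume "a > 0" "b > 0"
      from le[OF this(2,1)]
      show "(1 - q) * ln a + (1 - (1 - q)) * ln b - ln ((1 - p) * a + (1 - (1 - p)) * b) \<le> c"
        by (simp add: algebra_simps)
    qed (use q p 2 in auto)
    then show ?thesis by (simp add: kl_bin_swap)
  next
    case 3
    \<comment> \<open>At the optimal \<open>a = q / p\<close> and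
      \<open>b = (1 - q) / (1 - p)\<close> the argument of the last logarithm is 1.\<close>
    have "q * ln (q / p) + (1 - q) * ln ((1 - q) / (1 - p)) - ln (p * (q / p) + (1 - p) * ((1 - q) / (1 - p))) \<le> c"
      using 3 q p by (intro le) auto
    then show ?thesis using 3 by (simp add: kl_bin_def)
  qed
qed

text \<open>With \<open>r\<close> the density of \<open>Q\<close> with respect to \<open>P\<close>,
  the inequality \<open>ln y \<le> y - 1\<close> for \<open>y = exp (\<phi> x) / (r x * C)\<close>
  is integrated over \<open>Q\<close>. Changing the measure to \<open>P\<close> shows that
  \<open>y\<close> has \<open>Q\<close>-mean at most 1.\<close>

lemma Donsker_Varadhan_le:
  fixes \<phi> :: "'a \<Rightarrow> real"
  assumes P: "prob_space P" and Q: "prob_space Q" and sets: "sets Q = sets P"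
    and \<phi>[measurable]: "\<phi> \<in> borel_measurable P" and int: "integrable Q \<phi>"
    and C: "C > 0" "(\<integral>\<^sup>+x. ennreal (exp (\<phi> x)) \<partial>P) \<le> ennreal C"
  shows "ereal (\<integral>x. \<phi> x \<partial>Q) \<le> KLdiv Q P + ereal (ln C)"
proof (cases "absolutely_continuous P Q \<and> integrable Q (entropy_density (exp 1) P Q)")
  case False
  then show ?thesis unfolding KLdiv_def by auto
next
  case True
  interpret P: prob_space P by fact
  interpret Q: prob_space Q by fact
  note [measurable_cong] = sets
  define r where "r x = enn2real (RN_deriv P Q x)" for x
  have r_meas[measurable]: "r \<in> borel_measurable P" unfolding r_def by measurable
  have ent: "entropy_density (exp 1) P Q = (\<lambda>x. ln (r x))"
    by (auto simp: entropy_density_def r_def log_def)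
  have AC: "absolutely_continuous P Q" and int_ln: "integrable Q (\<lambda>x. ln (r x))"
    using True by (auto simp: ent)
  from P.real_RN_deriv[OF Q.finite_measure_axioms AC sets]
  obtain D where D: "D \<in> borel_measurable P" "AE x in P. RN_deriv P Q x = ennreal (D x)"
    "AE x in Q. 0 < D x" "\<And>x. 0 \<le> D x" by metis
  have r_RN: "AE x in P. RN_deriv P Q x = ennreal (r x)"
    using D(2) by eventually_elim (use D(4) in \<open>simp add: r_def\<close>)
  have "AE x in Q. RN_deriv P Q x = ennreal (D x)"
    using absolutely_continuous_AE[OF sets AC D(2)] .
  then have r_pos: "AE x in Q. 0 < r x"
    using D(3) by eventually_elim (simp add: r_def)
  let ?e = "\<lambda>x. exp (\<phi> x) / (r x * C)"
  have nn: "(\<integral>\<^sup>+x. ennreal (?e x) \<partial>Q) \<le> 1"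
  proof -
    have "(\<integral>\<^sup>+x. ennreal (?e x) \<partial>Q) = (\<integral>\<^sup>+x. RN_deriv P Q x * ennreal (?e x) \<partial>P)"
      by (rule P.RN_deriv_nn_integral[OF AC sets]) measurable
    \<comment> \<open>Only an inequality: where \<open>r x = 0\<close> the left integrand vanishes,
      while the right one does not.\<close>
    also have "\<dots> \<le> (\<integral>\<^sup>+x. ennreal (exp (\<phi> x)) * ennreal (1 / C) \<partial>P)"
    proof (rule nn_integral_mono_AE)
      show "AE x in P. RN_deriv P Q x * ennreal (?e x) \<le> ennreal (exp (\<phi> x)) * ennreal (1 / C)"
        using r_RN
      proof eventually_elim
        fix x assume "RN_deriv P Q x = ennreal (r x)"
        moreover have "0 \<le> r x" by (simp add: r_def)
        moreover from this have "r x * ?e x \<le> exp (\<phi> x) * (1 / C)"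
          using C by (cases "r x = 0") auto
        ultimately show "RN_deriv P Q x * ennreal (?e x) \<le> ennreal (exp (\<phi> x)) * ennreal (1 / C)"
          using C by (simp add: ennreal_mult[symmetric] ennreal_leI)
      qed
    qed
    also have "\<dots> = (\<integral>\<^sup>+x. ennreal (exp (\<phi> x)) \<partial>P) * ennreal (1 / C)"
      by (rule nn_integral_multc) measurable
    also have "\<dots> \<le> ennreal C * ennreal (1 / C)"
      by (rule mult_right_mono[OF C(2)]) simp
    also have "\<dots> = 1" using C by (simp add: ennreal_mult[symmetric])
    finally show ?thesis .
  qed
  have e_nonneg: "0 \<le> ?e x" for x using C by (simp add: r_def)
  have e_int: "integrable Q ?e"
  proof (rule integrableI_bounded)
    have "(\<integral>\<^sup>+x. ennreal (norm (?e x)) \<partial>Q) = (\<integral>\<^sup>+x. ennreal (?e x) \<partial>Q)"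
      using e_nonneg by (intro nn_integral_cong) (simp del: abs_divide)
    also have "\<dots> < \<infinity>" using nn by (rule le_less_trans) simp
    finally show "(\<integral>\<^sup>+x. ennreal (norm (?e x)) \<partial>Q) < \<infinity>" .
  qed measurable
  have e_le: "(\<integral>x. ?e x \<partial>Q) \<le> 1"
    using nn nn_integral_eq_integral[OF e_int] e_nonneg by simp
  have "(\<integral>x. \<phi> x \<partial>Q) - (\<integral>x. ln (r x) \<partial>Q) - ln C = (\<integral>x. \<phi> x - ln (r x) - ln C \<partial>Q)"
    using int int_ln by (simp add: Q.prob_space)
  also have "\<dots> \<le> (\<integral>x. ?e x - 1 \<partial>Q)"
  proof (rule integral_mono_AE)
    show "AE x in Q. \<phi> x - ln (r x) - ln C \<le> ?e x - 1"
      using r_pos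
    proof eventually_elim
      fix x assume r: "0 < r x"
      have "\<phi> x - ln (r x) - ln C = ln (?e x)"
        using r C by (simp add: ln_div ln_mult)
      also have "\<dots> \<le> ?e x - 1" using r C by (intro ln_le_minus_one) auto
      finally show "\<phi> x - ln (r x) - ln C \<le> ?e x - 1" .
    qed
  qed (use int int_ln e_int in auto)
  also have "\<dots> \<le> 0" using e_int e_le by (simp add: Q.prob_space)
  finally show ?thesis using True by (simp add: KLdiv_def KL_divergence_def ent)
qed

subsection \<open>The exponential moment of the binary divergence\<close>

lemma nn_integral_PiM_prod:
  assumes "finite I" and M: "\<And>i. i \<in> I \<Longrightarrow> prob_space (M i)"
    and f: "\<And>i. i \<in> I \<Longrightarrow> f i \<in> borel_measurable (M i)"
  shows "(\<integral>\<^sup>+x. (\<Prod>i\<in>I. f i (x i)) \<partial>PiM I M) = (\<Prod>i\<in>I. \<integral>\<^sup>+x. f i x \<partial>M i)"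
proof -
  \<comment> \<open>The locale \<open>product_sigma_finite\<close> constrains every index, so the
    family is padded outside \<open>I\<close> by a point mass.\<close>
  let ?M = "\<lambda>i. if i \<in> I then M i else return (count_space UNIV) undefined"
  interpret product_sigma_finite ?M
  proof (unfold product_sigma_finite_def, rule allI)
    fix i
    have "prob_space (?M i)" using M by (auto intro: prob_space_return)
    then show "sigma_finite_measure (?M i)" by (rule prob_space_imp_sigma_finite)
  qed
  have "(\<integral>\<^sup>+x. (\<Prod>i\<in>I. f i (x i)) \<partial>PiM I M) = (\<integral>\<^sup>+x. (\<Prod>i\<in>I. f i (x i)) \<partial>PiM I ?M)"
    by (rule arg_cong[where f = "\<lambda>N. integral\<^sup>N N _"]) (rule PiM_cong, auto)
  also have "\<dots> = (\<Prod>i\<in>I. integral\<^sup>N (?M i) (f i))"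
    using assms by (intro product_nn_integral_prod) auto
  also have "\<dots> = (\<Prod>i\<in>I. \<integral>\<^sup>+x. f i x \<partial>M i)" by (rule prod.cong) auto
  finally show ?thesis .
qed

lemma nn_integral_Beta:
  fixes a b :: real
  assumes "a > 0" "b > 0"
  shows "(\<integral>\<^sup>+t. ennreal (t powr (a - 1) * (1 - t) powr (b - 1) * indicator {0<..<1} t) \<partial>lborel) = ennreal (Beta a b)"
proof -
  have "((\<lambda>t. t powr (a - 1) * (1 - t) powr (b - 1)) has_integral Beta a b) {0<..<1}"
    using has_integral_Beta_real[OF assms] by (simp add: has_integral_Icc_iff_Ioo)
  from nn_integral_has_integral_lebesgue[OF _ this]
  have "ennreal (Beta a b) = (\<integral>\<^sup>+t. ennreal (indicator {0<..<1} t * (t powr (a - 1) * (1 - t) powr (b - 1))) \<partial>lborel)"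
    by (simp add: nn_integral_completion)
  then show ?thesis by (simp add: mult_ac)
qed

locale independent_samples =
  fixes n :: nat and m :: "nat \<Rightarrow> nat" and D :: "nat \<Rightarrow> 'z measure"
  assumes n_pos: "n \<ge> 1"
    and m_pos: "\<And>i. i < n \<Longrightarrow> m i \<ge> 1"
    and D_prob: "\<And>i. i < n \<Longrightarrow> prob_space (D i)"
begin

definition M :: nat where "M = (\<Sum>i<n. m i)"

abbreviation SD :: "(nat \<Rightarrow> nat \<Rightarrow> 'z) measure" where "SD \<equiv> sample_dist n m D"

lemma M_real: "real M = (\<Sum>i<n. real (m i))"
  by (simp add: M_def)

lemma M_pos: "M \<ge> 1"
proof -
  have "m 0 \<le> M" unfolding M_def using n_pos by (intro member_le_sum) auto
  then show ?thesis using m_pos[of 0] n_pos by simp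
qed

lemma prob_space_SD: "prob_space SD"
  unfolding sample_dist_def by (intro prob_space_PiM D_prob) auto

lemma measurable_sample:
  assumes "i < n" "j < m i"
  shows "(\<lambda>S. S i j) \<in> SD \<rightarrow>\<^sub>M D i"
proof -
  have "(\<lambda>S. S i) \<in> SD \<rightarrow>\<^sub>M PiM {..<m i} (\<lambda>_. D i)"
    unfolding sample_dist_def using assms by (intro measurable_component_singleton) auto
  moreover have "(\<lambda>s. s j) \<in> PiM {..<m i} (\<lambda>_. D i) \<rightarrow>\<^sub>M D i"
    using assms by (intro measurable_component_singleton) auto
  ultimately show ?thesis by (rule measurable_compose)
qed

lemma nn_integral_SD_prod:
  assumes g: "\<And>i. i < n \<Longrightarrow> g i \<in> borel_measurable (D i)"
  shows "(\<integral>\<^sup>+S. (\<Prod>i<n. \<Prod>j<m i. g i (S i j)) \<partial>SD) = (\<Prod>i<n. (\<integral>\<^sup>+z. g i z \<partial>D i) ^ m i)"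
proof -
  have "(\<integral>\<^sup>+S. (\<Prod>i<n. \<Prod>j<m i. g i (S i j)) \<partial>SD)
      = (\<Prod>i<n. \<integral>\<^sup>+s. (\<Prod>j<m i. g i (s j)) \<partial>PiM {..<m i} (\<lambda>_. D i))"
    unfolding sample_dist_def
    by (rule nn_integral_PiM_prod)
       (use g in \<open>auto intro!: prob_space_PiM D_prob borel_measurable_prod_ennreal
          measurable_compose[OF measurable_component_singleton]\<close>)
  also have "\<dots> = (\<Prod>i<n. (\<integral>\<^sup>+z. g i z \<partial>D i) ^ m i)"
    by (rule prod.cong[OF refl], subst nn_integral_PiM_prod) (auto intro!: D_prob g)
  finally show ?thesis .
qed

end

text \<open>This is the situation for one fixed tuple of predictors: \<open>X i\<close> is the loss
  of the predictor for task \<open>i\<close>, and only the samples are random.\<close>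

locale bounded_samples = independent_samples n m D
  for n m and D :: "nat \<Rightarrow> 'z measure" +
  fixes X :: "nat \<Rightarrow> 'z \<Rightarrow> real"
  assumes X_meas: "\<And>i. i < n \<Longrightarrow> X i \<in> borel_measurable (D i)"
    and X_range: "\<And>i z. i < n \<Longrightarrow> 0 \<le> X i z \<and> X i z \<le> 1"
begin

definition total :: "(nat \<Rightarrow> nat \<Rightarrow> 'z) \<Rightarrow> real" where
  "total S = (\<Sum>i<n. \<Sum>j<m i. X i (S i j))"

definition mean :: real where
  "mean = (\<Sum>i<n. real (m i) / real M * (\<integral>z. X i z \<partial>D i))"

lemma total_meas[measurable]: "total \<in> borel_measurable SD"
  unfolding total_def
  by (intro borel_measurable_sum measurable_compose[OF measurable_sample X_meas]) auto

lemma total_range: "0 \<le> total S" "total S \<le> real M"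
proof -
  show "0 \<le> total S" unfolding total_def using X_range by (intro sum_nonneg) auto
  have "total S \<le> (\<Sum>i<n. \<Sum>j<m i. 1)" unfolding total_def using X_range by (intro sum_mono) auto
  then show "total S \<le> real M" by (simp add: M_def)
qed

lemma X_integrable: "i < n \<Longrightarrow> integrable (D i) (X i)"
  using D_prob X_meas X_range
  by (intro finite_measure.integrable_const_bound[where B = 1] AE_I2) (auto simp: prob_space.finite_measure)

lemma X_mean_range:
  assumes "i < n"
  shows "0 \<le> (\<integral>z. X i z \<partial>D i)" "(\<integral>z. X i z \<partial>D i) \<le> 1"
proof -
  interpret prob_space "D i" using D_prob assms .
  show "0 \<le> (\<integral>z. X i z \<partial>D i)" using X_range assms by (intro Bochner_Integration.integral_nonneg) auto
  show "(\<integral>z. X i z \<partial>D i) \<le> 1"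
    using X_range assms X_integrable by (intro integral_le_const AE_I2) auto
qed

lemma M_mean: "real M * mean = (\<Sum>i<n. real (m i) * (\<integral>z. X i z \<partial>D i))"
  using M_pos by (simp add: mean_def sum_distrib_left)

lemma mean_range: "0 \<le> mean" "mean \<le> 1"
proof -
  show "0 \<le> mean" unfolding mean_def using X_mean_range by (intro sum_nonneg) auto
  have "real M * mean \<le> (\<Sum>i<n. real (m i) * 1)"
    unfolding M_mean using X_mean_range by (intro sum_mono mult_left_mono) auto
  also have "\<dots> = real M" by (simp add: M_def)
  finally show "mean \<le> 1" using M_pos by simp
qed

text \<open>By weighted AM-GM, \<open>a\<^sup>x b\<^sup>1\<^sup>-\<^sup>x \<le> x a + (1 - x) b\<close>, and the product of the resulting means
  is bounded through \<open>c \<le> exp (c - 1)\<close>. Only the average mean over all samples enters.\<close>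

lemma likelihood_ratio_mean_le_1:
  assumes ab: "a > 0" "b > 0" and eq: "mean * a + (1 - mean) * b = 1"
  shows "(\<integral>\<^sup>+S. ennreal (exp (total S * ln a + (real M - total S) * ln b)) \<partial>SD) \<le> 1"
proof -
  let ?\<mu> = "\<lambda>i. \<integral>z. X i z \<partial>D i"
  let ?g = "\<lambda>i z. ennreal (exp (X i z * ln a + (1 - X i z) * ln b))"
  let ?c = "\<lambda>i. ?\<mu> i * a + (1 - ?\<mu> i) * b"
  have M_eq: "real M = (\<Sum>i<n. \<Sum>j<m i. 1)" by (simp add: M_def)
  have "exp (total S * ln a + (real M - total S) * ln b)
      = (\<Prod>i<n. \<Prod>j<m i. exp (X i (S i j) * ln a + (1 - X i (S i j)) * ln b))" for S
    unfolding total_def M_eq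
    by (simp only: exp_sum[symmetric] finite_lessThan sum.distrib sum_subtractf sum_distrib_right)
       (simp add: algebra_simps sum_distrib_right sum.distrib sum_subtractf sum_distrib_left)
  then have "(\<integral>\<^sup>+S. ennreal (exp (total S * ln a + (real M - total S) * ln b)) \<partial>SD)
      = (\<integral>\<^sup>+S. (\<Prod>i<n. \<Prod>j<m i. ?g i (S i j)) \<partial>SD)"
    by (simp add: prod_ennreal prod_nonneg)
  also have "\<dots> = (\<Prod>i<n. (\<integral>\<^sup>+z. ?g i z \<partial>D i) ^ m i)"
    by (rule nn_integral_SD_prod) (use X_meas in measurable)
  also have "\<dots> \<le> (\<Prod>i<n. ennreal (exp (?c i - 1)) ^ m i)"
  proof (intro prod_mono_ennreal power_mono)
    fix i assume "i \<in> {..<n}"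
    then have i: "i < n" by simp
    interpret prob_space "D i" using D_prob i .
    have "?g i z \<le> ennreal (X i z * a + (1 - X i z) * b)" for z
      using Youngs_inequality_0[of "X i z" "1 - X i z" a b] X_range[OF i] ab
      by (intro ennreal_leI) (simp add: exp_add powr_def mult_ac)
    then have "(\<integral>\<^sup>+z. ?g i z \<partial>D i) \<le> (\<integral>\<^sup>+z. ennreal (X i z * a + (1 - X i z) * b) \<partial>D i)"
      by (intro nn_integral_mono) auto
    also have "\<dots> = ennreal (\<integral>z. X i z * a + (1 - X i z) * b \<partial>D i)"
      using X_range[OF i] ab X_integrable[OF i] by (intro nn_integral_eq_integral) auto
    also have "(\<integral>z. X i z * a + (1 - X i z) * b \<partial>D i) = ?c i"
      using X_integrable[OF i] by (simp add: prob_space)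
    also have "ennreal (?c i) \<le> ennreal (exp (?c i - 1))"
      using exp_ge_add_one_self[of "?c i - 1"] by (intro ennreal_leI) simp
    finally show "(\<integral>\<^sup>+z. ?g i z \<partial>D i) \<le> ennreal (exp (?c i - 1))" .
  qed auto
  also have "\<dots> = ennreal (exp (\<Sum>i<n. real (m i) * (?c i - 1)))"
    by (simp add: exp_sum exp_of_nat_mult ennreal_power prod_ennreal)
  also have "(\<Sum>i<n. real (m i) * (?c i - 1))
      = (\<Sum>i<n. real (m i) * ?\<mu> i) * a + ((\<Sum>i<n. real (m i)) - (\<Sum>i<n. real (m i) * ?\<mu> i)) * b - (\<Sum>i<n. real (m i))"
    by (simp add: algebra_simps sum_distrib_left sum_distrib_right sum.distrib sum_subtractf)
  also have "\<dots> = real M * (mean * a + (1 - mean) * b - 1)"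
    unfolding M_mean[symmetric] by (simp add: M_def algebra_simps)
  also have "\<dots> = 0" using eq by simp
  finally show ?thesis by simp
qed

text \<open>The exponential of \<open>M kl\<close> is the likelihood ratio maximised over the Bernoulli parameter; up to
  the factor \<open>2 \<surd>M\<close> it is dominated by the ratio averaged over the arcsine (Krichevsky-Trofimov)
  prior.\<close>

lemma exp_kl_mean_le_interior:
  assumes p: "0 < mean" "mean < 1"
  shows "(\<integral>\<^sup>+S. ennreal (exp (total S * ln (total S / M / mean) + (M - total S) * ln ((M - total S) / M / (1 - mean)))) \<partial>SD)
    \<le> ennreal (2 * sqrt M)"
proof -
  interpret SD: prob_space SD by (rule prob_space_SD)
  interpret pair_sigma_finite SD lborel by unfold_locales
  have M0: "real M > 0" using M_pos by simp
  \<comment> \<open>\<open>L t S\<close> is the likelihood ratio of Bernoulli parameter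
    \<open>t\<close> against \<open>mean\<close>, extended to real counts. The weight
    \<open>w\<close> is the arcsine density without its normalising factor; its total mass is
    \<open>Beta (1/2) (1/2) = pi\<close>.\<close>
  define L where "L t S = exp (total S * ln (t / mean) + (M - total S) * ln ((1 - t) / (1 - mean)))" for t S
  define w :: "real \<Rightarrow> real" where "w t = t powr (1/2 - 1) * (1 - t) powr (1/2 - 1) * indicator {0<..<1} t" for t
  have [measurable]: "(\<lambda>x. L (snd x) (fst x)) \<in> borel_measurable (SD \<Otimes>\<^sub>M lborel)"
    unfolding L_def by measurable
  have [measurable]: "w \<in> borel_measurable lborel" unfolding w_def by measurable
  have w_nonneg: "0 \<le> w t" for t by (simp add: w_def)
  have L_nonneg: "0 \<le> L t S" for t S by (simp add: L_def)
  have pointwise: "ennreal (exp (total S * ln (total S / M / mean) + (M - total S) * ln ((M - total S) / M / (1 - mean))))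
      \<le> ennreal (2 * sqrt M / pi) * (\<integral>\<^sup>+t. ennreal (w t * L t S) \<partial>lborel)" for S
  proof -
    define k where "k = total S"
    have k: "0 \<le> k" "k \<le> M" using total_range by (auto simp: k_def)
    have e: "x * ln (x / M / y) = x * ln (x / M) - x * ln y" if "x \<ge> 0" "y > 0" for x y :: real
      using that M0 by (cases "x = 0") (auto simp: ln_div ln_mult algebra_simps)
    have expand: "exp (k * ln (k / M / mean) + (M - k) * ln ((M - k) / M / (1 - mean)))
        = exp (k * ln (k / M) + (M - k) * ln ((M - k) / M)) * exp (- k * ln mean - (M - k) * ln (1 - mean))"
      using e[of k mean] e[of "M - k" "1 - mean"] k p by (simp add: exp_add[symmetric])
    have "\<dots> \<le> 2 * sqrt M / pi * Beta (k + 1/2) (M - k + 1/2) * exp (- k * ln mean - (M - k) * ln (1 - mean))"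
      using k M_pos by (intro mult_right_mono entropy_le_Beta_half) auto
    then have "ennreal (exp (k * ln (k / M / mean) + (M - k) * ln ((M - k) / M / (1 - mean))))
        \<le> ennreal (2 * sqrt M / pi) * (ennreal (Beta (k + 1/2) (M - k + 1/2)) * ennreal (exp (- k * ln mean - (M - k) * ln (1 - mean))))"
      using k unfolding expand by (simp add: ennreal_mult[symmetric] ennreal_leI Beta_def mult_ac)
    also have "ennreal (Beta (k + 1/2) (M - k + 1/2)) * ennreal (exp (- k * ln mean - (M - k) * ln (1 - mean)))
        = (\<integral>\<^sup>+t. ennreal (t powr (k + 1/2 - 1) * (1 - t) powr (M - k + 1/2 - 1) * indicator {0<..<1} t)
              * ennreal (exp (- k * ln mean - (M - k) * ln (1 - mean))) \<partial>lborel)"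
      using k by (subst nn_integral_multc) (simp_all only: nn_integral_Beta, auto)
    also have "\<dots> = (\<integral>\<^sup>+t. ennreal (w t * L t S) \<partial>lborel)"
    proof (rule nn_integral_cong)
      fix t :: real
      show "ennreal (t powr (k + 1/2 - 1) * (1 - t) powr (M - k + 1/2 - 1) * indicator {0<..<1} t)
          * ennreal (exp (- k * ln mean - (M - k) * ln (1 - mean))) = ennreal (w t * L t S)"
      proof (cases "t \<in> {0<..<1}")
        case True
        have "t powr (k + 1/2 - 1) * (1 - t) powr (M - k + 1/2 - 1) * exp (- k * ln mean - (M - k) * ln (1 - mean)) = w t * L t S"
          using True p unfolding w_def L_def k_def[symmetric]
          by (simp add: powr_def exp_add[symmetric] ln_div) (simp add: algebra_simps)
        then show ?thesis using True by (simp add: ennreal_mult[symmetric])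
      qed (simp add: w_def)
    qed
    finally show ?thesis by (simp add: k_def)
  qed
  have "(\<integral>\<^sup>+S. ennreal (exp (total S * ln (total S / M / mean) + (M - total S) * ln ((M - total S) / M / (1 - mean)))) \<partial>SD)
      \<le> (\<integral>\<^sup>+S. ennreal (2 * sqrt M / pi) * (\<integral>\<^sup>+t. ennreal (w t * L t S) \<partial>lborel) \<partial>SD)"
    by (intro nn_integral_mono pointwise)
  also have "\<dots> = ennreal (2 * sqrt M / pi) * (\<integral>\<^sup>+S. (\<integral>\<^sup>+t. ennreal (w t * L t S) \<partial>lborel) \<partial>SD)"
    by (rule nn_integral_cmult) measurable
  also have "(\<integral>\<^sup>+S. (\<integral>\<^sup>+t. ennreal (w t * L t S) \<partial>lborel) \<partial>SD) = (\<integral>\<^sup>+t. (\<integral>\<^sup>+S. ennreal (w t * L t S) \<partial>SD) \<partial>lborel)"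
    by (rule Fubini'[symmetric]) measurable
  also have "\<dots> \<le> (\<integral>\<^sup>+t. ennreal (w t) \<partial>lborel)"
  proof (rule nn_integral_mono)
    fix t :: real
    show "(\<integral>\<^sup>+S. ennreal (w t * L t S) \<partial>SD) \<le> ennreal (w t)"
    proof (cases "t \<in> {0<..<1}")
      case True
      have "(\<integral>\<^sup>+S. ennreal (w t * L t S) \<partial>SD) = ennreal (w t) * (\<integral>\<^sup>+S. ennreal (L t S) \<partial>SD)"
        using w_nonneg L_nonneg
        by (subst nn_integral_cmult[symmetric]) (auto simp: ennreal_mult L_def)
      also have "\<dots> \<le> ennreal (w t) * 1"
        \<comment> \<open>For \<open>a = t / mean\<close> and
          \<open>b = (1 - t) / (1 - mean)\<close> the normalisation
          \<open>mean * a + (1 - mean) * b = 1\<close> holds.\<close>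
        unfolding L_def using True p by (intro mult_left_mono likelihood_ratio_mean_le_1) auto
      finally show ?thesis by simp
    qed (simp add: w_def)
  qed
  also have "(\<integral>\<^sup>+t. ennreal (w t) \<partial>lborel) = ennreal pi"
    unfolding w_def using nn_integral_Beta[of "1/2" "1/2"] by (simp add: Beta_def Gamma_one_half_real)
  finally show ?thesis
    by (auto simp: ennreal_mult[symmetric] mult_left_mono)
qed

text \<open>Nonnegative summands with sum zero vanish, so each \<open>X i\<close> is zero almost
  everywhere. Positive totals, for which the divergence from 0 is infinite, thus form a null
  set.\<close>

lemma AE_total_eq_0:
  assumes "mean = 0"
  shows "AE S in SD. total S = 0"
proof -
  have "(\<Sum>i<n. real (m i) * (\<integral>z. X i z \<partial>D i)) = 0" using M_mean assms by simp
  then have *: "\<forall>i\<in>{..<n}. real (m i) * (\<integral>z. X i z \<partial>D i) = 0"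
    using X_mean_range by (subst (asm) sum_nonneg_eq_0_iff) auto
  have "AE S in SD. \<forall>i\<in>{..<n}. \<forall>j\<in>{..<m i}. X i (S i j) = 0"
  proof (intro AE_finite_allI finite_lessThan)
    fix i j assume ij: "i \<in> {..<n}" "j \<in> {..<m i}"
    then have "real (m i) * (\<integral>z. X i z \<partial>D i) = 0" "real (m i) > 0"
      using * by blast (use ij in auto)
    then have "(\<integral>z. X i z \<partial>D i) = 0" by simp
    then have "AE z in D i. X i z = 0"
      using integral_nonneg_eq_0_iff_AE[OF X_integrable] X_range ij by auto
    then have "AE s in PiM {..<m i} (\<lambda>_. D i). X i (s j) = 0"
      using ij D_prob AE_PiM_component[of "{..<m i}" "\<lambda>_. D i" j] by auto
    then show "AE S in SD. X i (S i j) = 0"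
      unfolding sample_dist_def
      using ij D_prob AE_PiM_component[of "{..<n}" "\<lambda>i. PiM {..<m i} (\<lambda>_. D i)" i "\<lambda>s. X i (s j) = 0"]
      by (auto intro: prob_space_PiM)
  qed
  then show ?thesis by eventually_elim (simp add: total_def)
qed

text \<open>Replacing each \<open>X i\<close> by \<open>1 - X i\<close> reduces this to mean
  zero.\<close>

lemma AE_total_eq_M:
  assumes "mean = 1"
  shows "AE S in SD. total S = real M"
proof -
  interpret flip: bounded_samples n m D "\<lambda>i z. 1 - X i z"
    by unfold_locales (use X_range X_meas in auto)
  have \<mu>: "(\<integral>z. 1 - X i z \<partial>D i) = 1 - (\<integral>z. X i z \<partial>D i)" if "i < n" for i
  proof -
    interpret prob_space "D i" using D_prob that .
    show ?thesis using X_integrable[OF that] by (simp add: prob_space)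
  qed
  have "real M * flip.mean = (\<Sum>i<n. real (m i) - real (m i) * (\<integral>z. X i z \<partial>D i))"
    unfolding flip.M_mean by (intro sum.cong) (auto simp: \<mu> algebra_simps)
  also have "\<dots> = real M - real M * mean" by (simp add: M_mean sum_subtractf) (simp add: M_def)
  finally have "flip.mean = 0" using assms M_pos by simp
  from flip.AE_total_eq_0[OF this] show ?thesis
    by eventually_elim (simp add: flip.total_def total_def sum_subtractf M_def)
qed

end

text \<open>The infinite case is separate because \<open>real_of_ereal\<close> sends infinity to
  0.\<close>

definition exp_kl :: "real \<Rightarrow> real \<Rightarrow> real \<Rightarrow> ennreal" where
  "exp_kl c q p = (if kl_bin q p = \<infinity> then \<infinity> else ennreal (exp (c * real_of_ereal (kl_bin q p))))"

lemma measurable_exp_kl[measurable]: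
  assumes [measurable]: "f \<in> borel_measurable N" "g \<in> borel_measurable N"
  shows "(\<lambda>x. exp_kl c (f x) (g x)) \<in> borel_measurable N"
  unfolding exp_kl_def kl_bin_def by measurable

text \<open>The moment of \<open>exp_kl\<close> thus controls the moments of the variational
  expressions for all \<open>a\<close> and \<open>b\<close> at once, so a single event serves every
  choice of them.\<close>

lemma exp_variational_le_exp_kl:
  assumes "0 \<le> q" "q \<le> 1" "0 \<le> p" "p \<le> 1" "a > 0" "b > 0" "c \<ge> 0"
  shows "ennreal (exp (c * (q * ln a + (1 - q) * ln b - ln (p * a + (1 - p) * b)))) \<le> exp_kl c q p"
proof -
  have "ereal (q * ln a + (1 - q) * ln b - ln (p * a + (1 - p) * b)) \<le> kl_bin q p"
    using assms by (intro kl_bin_ge_variational) auto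
  then show ?thesis
    using assms by (cases "kl_bin q p") (auto simp: exp_kl_def intro!: ennreal_leI mult_left_mono)
qed

text \<open>If the mean is 0 or 1, the empirical average equals it almost surely and the integrand
  is 1. Otherwise the divergence is given by the finite formula of the interior case.\<close>

lemma (in bounded_samples) exp_kl_mean_le:
  "(\<integral>\<^sup>+S. exp_kl M (total S / M) mean \<partial>SD) \<le> ennreal (2 * sqrt M)"
proof -
  interpret SD: prob_space SD by (rule prob_space_SD)
  have M0: "real M > 0" using M_pos by simp
  have degenerate: ?thesis if "AE S in SD. exp_kl M (total S / M) mean = 1"
  proof -
    have "(\<integral>\<^sup>+S. exp_kl M (total S / M) mean \<partial>SD) = (\<integral>\<^sup>+S. 1 \<partial>SD)"
      by (rule nn_integral_cong_AE) fact
    also have "\<dots> = ennreal 1" by (simp add: SD.emeasure_space_1)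
    also have "\<dots> \<le> ennreal (2 * sqrt M)"
    proof (rule ennreal_leI)
      have "1 \<le> sqrt M" using M_pos by simp
      then show "1 \<le> 2 * sqrt M" by linarith
    qed
    finally show ?thesis .
  qed
  consider "mean = 0" | "mean = 1" | "0 < mean" "mean < 1" using mean_range by linarith
  then show ?thesis
  proof cases
    case 1
    have "AE S in SD. exp_kl M (total S / M) mean = 1"
      using AE_total_eq_0[OF 1] by eventually_elim (simp add: 1 exp_kl_def kl_bin_def)
    then show ?thesis by (rule degenerate)
  next
    case 2
    have "AE S in SD. exp_kl M (total S / M) mean = 1"
      using AE_total_eq_M[OF 2] by eventually_elim (use M0 in \<open>simp add: 2 exp_kl_def kl_bin_def\<close>)
    then show ?thesis by (rule degenerate)
  next
    case 3
    have "exp_kl M (total S / M) mean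
        = ennreal (exp (total S * ln (total S / M / mean) + (M - total S) * ln ((M - total S) / M / (1 - mean))))" for S
    proof -
      have "kl_bin (total S / M) mean
        = ereal (total S / M * ln (total S / M / mean) + (1 - total S / M) * ln ((1 - total S / M) / (1 - mean)))"
        using 3 by (auto simp: kl_bin_def)
      moreover have "1 - total S / M = (M - total S) / M" using M0 by (simp add: field_simps)
      ultimately show ?thesis using M0 by (simp add: exp_kl_def distrib_left)
    qed
    then show ?thesis using exp_kl_mean_le_interior[OF 3] by simp
  qed
qed

subsection \<open>The PAC-Bayes inequality\<close>

text \<open>The integrand is bounded: a convex combination of \<open>a\<close> and \<open>b\<close>
  lies between their minimum and maximum, so each logarithmic part is at most
  \<open>\<bar>ln a\<bar> + \<bar>ln b\<bar>\<close> in absolute value.\<close>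

lemma integrable_variational:
  fixes f g :: "'w \<Rightarrow> real"
  assumes Q: "prob_space Q" and [measurable]: "f \<in> borel_measurable Q" "g \<in> borel_measurable Q"
    and f: "\<And>x. 0 \<le> f x \<and> f x \<le> 1" and g: "\<And>x. 0 \<le> g x \<and> g x \<le> 1"
    and ab: "a > 0" "b > 0"
  shows "integrable Q (\<lambda>x. f x * ln a + (1 - f x) * ln b - ln (g x * a + (1 - g x) * b))"
proof -
  interpret Q: prob_space Q by fact
  define B where "B = \<bar>ln a\<bar> + \<bar>ln b\<bar>"
  have bound: "\<bar>x * ln a + (1 - x) * ln b\<bar> \<le> B" if "0 \<le> x" "x \<le> 1" for x
  proof -
    have "\<bar>x * ln a\<bar> \<le> \<bar>ln a\<bar>" "\<bar>(1 - x) * ln b\<bar> \<le> \<bar>ln b\<bar>"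
      using that by (auto simp: abs_mult intro: mult_left_le_one_le)
    then show ?thesis unfolding B_def by linarith
  qed
  have bound_ln: "\<bar>ln (x * a + (1 - x) * b)\<bar> \<le> B" if x: "0 \<le> x" "x \<le> 1" for x
  proof -
    have "min a b \<le> x * a + (1 - x) * b" "x * a + (1 - x) * b \<le> max a b"
      using convex_bound_le[of a "max a b" b x "1 - x"] convex_bound_le[of "-a" "- min a b" "-b" x "1 - x"] x
      by auto
    moreover from this have "0 < x * a + (1 - x) * b" using ab by (auto simp: min_def split: if_splits)
    ultimately have "ln (min a b) \<le> ln (x * a + (1 - x) * b)" "ln (x * a + (1 - x) * b) \<le> ln (max a b)"
      using ab by auto
    then show ?thesis unfolding B_def by (auto simp: min_def max_def split: if_splits)
  qed
  show ?thesis
  proof (rule Q.integrable_const_bound[where B = "2 * B"])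
    show "AE x in Q. norm (f x * ln a + (1 - f x) * ln b - ln (g x * a + (1 - g x) * b)) \<le> 2 * B"
    proof (rule AE_I2)
      fix x
      show "norm (f x * ln a + (1 - f x) * ln b - ln (g x * a + (1 - g x) * b)) \<le> 2 * B"
        using bound[of "f x"] bound_ln[of "g x"] f[of x] g[of x] unfolding real_norm_def by linarith
    qed
  qed measurable
qed

lemma variational_Jensen:
  fixes f g :: "'w \<Rightarrow> real"
  assumes Q: "prob_space Q" and [measurable]: "f \<in> borel_measurable Q" "g \<in> borel_measurable Q"
    and f: "\<And>x. 0 \<le> f x \<and> f x \<le> 1" and g: "\<And>x. 0 \<le> g x \<and> g x \<le> 1"
    and ab: "a > 0" "b > 0"
  defines "q \<equiv> (\<integral>x. f x \<partial>Q)" and "p \<equiv> (\<integral>x. g x \<partial>Q)"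
  shows "q * ln a + (1 - q) * ln b - ln (p * a + (1 - p) * b)
    \<le> (\<integral>x. f x * ln a + (1 - f x) * ln b - ln (g x * a + (1 - g x) * b) \<partial>Q)"
proof -
  interpret Q: prob_space Q by fact
  have pos: "0 < x * a + (1 - x) * b" if "0 \<le> x" "x \<le> 1" for x
  proof (cases "x = 0")
    case False
    then show ?thesis using that ab by (auto intro!: add_pos_nonneg)
  qed (use ab in simp)
  have int_f: "integrable Q f" and int_g: "integrable Q g"
    using f g by (auto intro!: Q.integrable_const_bound[where B = 1])
  have p01: "0 \<le> p" "p \<le> 1"
    using g int_g unfolding p_def by (auto intro!: Bochner_Integration.integral_nonneg Q.integral_le_const)
  define c where "c = p * a + (1 - p) * b"
  have c: "c > 0" unfolding c_def using p01 by (rule pos)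
  \<comment> \<open>The logarithm of the mixture is replaced by its tangent at \<open>c\<close>. As
    \<open>c\<close> is the mean of the mixture, the linear correction integrates to zero; concavity
    of \<open>ln\<close> gives the pointwise comparison.\<close>
  let ?h = "\<lambda>x. f x * ln a + (1 - f x) * ln b - (ln c + (g x * a + (1 - g x) * b - c) / c)"
  have "q * ln a + (1 - q) * ln b - ln c = (\<integral>x. ?h x \<partial>Q)"
    using int_f int_g by (simp add: Q.prob_space q_def[symmetric] p_def[symmetric] c_def[symmetric])
  also have "\<dots> \<le> (\<integral>x. f x * ln a + (1 - f x) * ln b - ln (g x * a + (1 - g x) * b) \<partial>Q)"
  proof (rule integral_mono)
    show "integrable Q ?h" using int_f int_g by simp
    show "integrable Q (\<lambda>x. f x * ln a + (1 - f x) * ln b - ln (g x * a + (1 - g x) * b))"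
      using assms by (intro integrable_variational) auto
    fix x
    let ?y = "g x * a + (1 - g x) * b"
    have y: "?y > 0" using g[of x] by (intro pos) auto
    have "ln (?y / c) \<le> ?y / c - 1" using y c by (intro ln_le_minus_one) auto
    also have "\<dots> = (?y - c) / c" using c by (simp add: diff_divide_distrib)
    finally have "ln ?y \<le> ln c + (?y - c) / c" using y c by (simp add: ln_div)
    then show "?h x \<le> f x * ln a + (1 - f x) * ln b - ln ?y" by simp
  qed
  finally show ?thesis by (simp add: c_def)
qed

text \<open>The space of \<open>w\<close> stays abstract: no product structure of \<open>P\<close>
  is assumed, which admits the hierarchical prior, where the predictors may be dependent.\<close>

locale random_losses = independent_samples n m D + P: prob_space P
  for n m and D :: "nat \<Rightarrow> 'z measure" and P :: "'w measure" +
  fixes Y :: "nat \<Rightarrow> 'w \<Rightarrow> 'z \<Rightarrow> real"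
  assumes Y_meas: "\<And>i. i < n \<Longrightarrow> (\<lambda>(w, z). Y i w z) \<in> borel_measurable (P \<Otimes>\<^sub>M D i)"
    and Y_range: "\<And>i w z. i < n \<Longrightarrow> 0 \<le> Y i w z \<and> Y i w z \<le> 1"
begin

definition emp :: "'w \<Rightarrow> (nat \<Rightarrow> nat \<Rightarrow> 'z) \<Rightarrow> real" where
  "emp w S = (\<Sum>i<n. \<Sum>j<m i. Y i w (S i j)) / real M"

definition true_risk :: "'w \<Rightarrow> real" where
  "true_risk w = (\<Sum>i<n. real (m i) / real M * (\<integral>z. Y i w z \<partial>D i))"

lemma bounded_samples_at:
  assumes "w \<in> space P"
  shows "bounded_samples n m D (\<lambda>i. Y i w)"
proof
  fix i assume i: "i < n"
  show "Y i w \<in> borel_measurable (D i)"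
    using measurable_compose[OF measurable_Pair1'[OF assms] Y_meas[OF i]] by simp
qed (use Y_range in auto)

lemma emp_range: "0 \<le> emp w S \<and> emp w S \<le> 1"
proof -
  have "(\<Sum>i<n. \<Sum>j<m i. Y i w (S i j)) \<le> (\<Sum>i<n. \<Sum>j<m i. 1)"
    using Y_range by (intro sum_mono) auto
  moreover have "0 \<le> (\<Sum>i<n. \<Sum>j<m i. Y i w (S i j))"
    using Y_range by (intro sum_nonneg) auto
  ultimately show ?thesis using M_pos by (simp add: emp_def M_real[symmetric])
qed

lemma true_risk_range: "0 \<le> true_risk w \<and> true_risk w \<le> 1"
proof -
  have 1: "0 \<le> (\<integral>z. Y i w z \<partial>D i) \<and> (\<integral>z. Y i w z \<partial>D i) \<le> 1" if i: "i < n" for i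
  proof -
    interpret prob_space "D i" using D_prob i .
    have "(\<integral>z. Y i w z \<partial>D i) \<le> 1"
    \<comment> \<open>The range is claimed for every \<open>w\<close>, also outside
      \<open>space P\<close>. A non-integrable section has integral 0 by convention.\<close>
    proof (cases "integrable (D i) (Y i w)")
      case True
      then show ?thesis using Y_range[OF i] by (intro integral_le_const) auto
    qed (simp add: not_integrable_integral_eq)
    then show ?thesis using Y_range[OF i] by (auto intro!: Bochner_Integration.integral_nonneg)
  qed
  have "true_risk w \<le> (\<Sum>i<n. real (m i) / real M * 1)"
    unfolding true_risk_def using 1 by (intro sum_mono mult_left_mono) auto
  also have "\<dots> = 1" using M_pos by (simp add: sum_divide_distrib[symmetric] M_real[symmetric])
  finally show ?thesis unfolding true_risk_def using 1 by (auto intro!: sum_nonneg)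
qed

lemma emp_meas_pair[measurable]: "(\<lambda>x. emp (fst x) (snd x)) \<in> borel_measurable (P \<Otimes>\<^sub>M SD)"
  unfolding emp_def
proof (intro borel_measurable_divide borel_measurable_sum borel_measurable_const)
  fix i j assume ij: "i \<in> {..<n}" "j \<in> {..<m i}"
  then have [measurable]: "(\<lambda>S. S i j) \<in> SD \<rightarrow>\<^sub>M D i" by (intro measurable_sample) auto
  have "(\<lambda>x. (fst x, snd x i j)) \<in> P \<Otimes>\<^sub>M SD \<rightarrow>\<^sub>M P \<Otimes>\<^sub>M D i" by measurable
  from measurable_compose[OF this Y_meas] ij
  show "(\<lambda>x. Y i (fst x) (snd x i j)) \<in> borel_measurable (P \<Otimes>\<^sub>M SD)" by simp
qed

lemma emp_meas: "S \<in> space SD \<Longrightarrow> (\<lambda>w. emp w S) \<in> borel_measurable P"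
  using measurable_compose[OF measurable_Pair2' emp_meas_pair] by simp

lemma true_risk_meas[measurable]: "true_risk \<in> borel_measurable P"
  unfolding true_risk_def
proof (intro borel_measurable_sum borel_measurable_times borel_measurable_const)
  fix i assume "i \<in> {..<n}"
  then have i: "i < n" by simp
  interpret prob_space "D i" using D_prob i .
  show "(\<lambda>w. \<integral>z. Y i w z \<partial>D i) \<in> borel_measurable P"
    using Y_meas[OF i] by (rule borel_measurable_lebesgue_integral)
qed

lemma PAC_Bayes_kl:
  assumes \<delta>: "\<delta> > 0"
  shows "\<exists>E \<in> sets SD. measure SD E \<ge> 1 - \<delta> \<and>
    (\<forall>S\<in>E. \<forall>Q. prob_space Q \<longrightarrow> sets Q = sets P \<longrightarrow>
       kl_bin (\<integral>w. emp w S \<partial>Q) (\<integral>w. true_risk w \<partial>Q)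
         \<le> (KLdiv Q P + ereal (ln (2 * sqrt (real M) / \<delta>))) / ereal (real M))"
proof -
  interpret SD: prob_space SD by (rule prob_space_SD)
  interpret pair_sigma_finite P SD by unfold_locales
  have M0: "real M > 0" using M_pos by simp
  define C where "C = 2 * sqrt (real M) / \<delta>"
  have C: "C > 0" using M0 \<delta> by (simp add: C_def)
  define G where "G S = (\<integral>\<^sup>+w. exp_kl M (emp w S) (true_risk w) \<partial>P)" for S
  have [measurable]: "(\<lambda>x. exp_kl M (emp (fst x) (snd x)) (true_risk (fst x))) \<in> borel_measurable (P \<Otimes>\<^sub>M SD)"
    by measurable
  have [measurable]: "(\<lambda>(S, w). exp_kl M (emp w S) (true_risk w)) \<in> borel_measurable (SD \<Otimes>\<^sub>M P)"
    by (subst measurable_pair_swap_iff) (simp add: split_beta')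
  have G_meas[measurable]: "G \<in> borel_measurable SD"
    unfolding G_def by measurable
  \<comment> \<open>The prior does not depend on the sample, so the order of integration can be
    exchanged.\<close>
  have "(\<integral>\<^sup>+S. G S \<partial>SD) = (\<integral>\<^sup>+w. (\<integral>\<^sup>+S. exp_kl M (emp w S) (true_risk w) \<partial>SD) \<partial>P)"
    unfolding G_def by (rule Fubini') (simp add: split_beta')
  also have "\<dots> \<le> (\<integral>\<^sup>+w. ennreal (2 * sqrt M) \<partial>P)"
  proof (rule nn_integral_mono)
    fix w assume "w \<in> space P"
    then interpret bounded_samples n m D "\<lambda>i. Y i w" by (rule bounded_samples_at)
    show "(\<integral>\<^sup>+S. exp_kl M (emp w S) (true_risk w) \<partial>SD) \<le> ennreal (2 * sqrt M)"
      using exp_kl_mean_le by (simp add: total_def mean_def emp_def true_risk_def)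
  qed
  also have "\<dots> = ennreal (2 * sqrt M)" by (simp add: P.emeasure_space_1)
  finally have G_le: "(\<integral>\<^sup>+S. G S \<partial>SD) \<le> ennreal (2 * sqrt M)" .

  define E where "E = {S \<in> space SD. G S \<le> ennreal C}"
  have E_sets: "E \<in> sets SD" unfolding E_def by measurable
  have "1 - \<delta> \<le> measure SD E"
  proof -
    \<comment> \<open>Markov's inequality: outside \<open>E\<close> the moment \<open>G S\<close>
      exceeds \<open>C\<close>.\<close>
    have "ennreal C * emeasure SD (space SD - E) = (\<integral>\<^sup>+S. ennreal C * indicator (space SD - E) S \<partial>SD)"
      using E_sets by (subst nn_integral_cmult_indicator) auto
    also have "\<dots> \<le> (\<integral>\<^sup>+S. G S \<partial>SD)"
      by (intro nn_integral_mono) (auto simp: E_def indicator_def not_le intro: less_imp_le)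
    also note G_le
    finally have "ennreal (C * measure SD (space SD - E)) \<le> ennreal (2 * sqrt M)"
      using C by (simp add: SD.emeasure_eq_measure ennreal_mult)
    then have "C * measure SD (space SD - E) \<le> 2 * sqrt M" by (simp add: ennreal_le_iff)
    also have "2 * sqrt M = C * \<delta>" using \<delta> by (simp add: C_def)
    finally have "measure SD (space SD - E) \<le> \<delta>" using C by simp
    then show ?thesis using SD.prob_compl[OF E_sets] by simp
  qed
  moreover have "kl_bin (\<integral>w. emp w S \<partial>Q) (\<integral>w. true_risk w \<partial>Q)
         \<le> (KLdiv Q P + ereal (ln C)) / ereal (real M)"
    if S: "S \<in> E" and Q: "prob_space Q" and sets: "sets Q = sets P" for S Q
  proof (cases "KLdiv Q P = \<infinity>")
    case True
    then show ?thesis using M0 by simp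
  next
    case False
    \<comment> \<open>By definition \<open>KLdiv\<close> is either real or plus infinity.\<close>
    then obtain \<kappa> where \<kappa>: "KLdiv Q P = ereal \<kappa>" unfolding KLdiv_def by (auto split: if_splits)
    interpret Q: prob_space Q by fact
    note [measurable_cong] = sets
    have S_space: "S \<in> space SD" using S by (simp add: E_def)
    note [measurable] = emp_meas[OF S_space]
    let ?q = "\<integral>w. emp w S \<partial>Q" and ?p = "\<integral>w. true_risk w \<partial>Q"
    have "integrable Q (\<lambda>w. emp w S)" "integrable Q true_risk"
      using emp_range true_risk_range by (auto intro!: Q.integrable_const_bound[where B = 1])
    then have range: "0 \<le> ?q" "?q \<le> 1" "0 \<le> ?p" "?p \<le> 1"
      using emp_range true_risk_range
      by (auto intro!: Bochner_Integration.integral_nonneg Q.integral_le_const)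
    have "kl_bin ?q ?p \<le> ereal ((\<kappa> + ln C) / M)"
    proof (rule kl_bin_le_variational[OF range])
      fix a b :: real assume ab: "a > 0" "b > 0"
      let ?v = "\<lambda>w. emp w S * ln a + (1 - emp w S) * ln b - ln (true_risk w * a + (1 - true_risk w) * b)"
      have v_int: "integrable Q ?v"
        using Q emp_range true_risk_range ab by (intro integrable_variational) auto
      have "(\<integral>\<^sup>+w. ennreal (exp (M * ?v w)) \<partial>P) \<le> G S"
        unfolding G_def using emp_range true_risk_range ab
        by (intro nn_integral_mono exp_variational_le_exp_kl) auto
      also have "\<dots> \<le> ennreal C" using S by (simp add: E_def)
      finally have "ereal (\<integral>w. M * ?v w \<partial>Q) \<le> KLdiv Q P + ereal (ln C)"
        using v_int C P.prob_space_axioms Q sets by (intro Donsker_Varadhan_le) auto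
      then have "M * (\<integral>w. ?v w \<partial>Q) \<le> \<kappa> + ln C" by (simp add: \<kappa>)
      then have "(\<integral>w. ?v w \<partial>Q) \<le> (\<kappa> + ln C) / M" using M0 by (simp add: field_simps)
      moreover have "?q * ln a + (1 - ?q) * ln b - ln (?p * a + (1 - ?p) * b) \<le> (\<integral>w. ?v w \<partial>Q)"
        using Q emp_range true_risk_range ab by (intro variational_Jensen) auto
      ultimately show "?q * ln a + (1 - ?q) * ln b - ln (?p * a + (1 - ?p) * b) \<le> (\<kappa> + ln C) / M"
        by linarith
    qed
    then show ?thesis using M0 by (simp add: \<kappa>)
  qed
  ultimately show ?thesis using E_sets unfolding C_def by blast
qed

end

section \<open>Measurability and marginals of the joint prior and posterior\<close>

lemma measurable_PiM_prob_algebra: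
  assumes "finite I"
  shows "(\<lambda>P. PiM I (\<lambda>_. P)) \<in> prob_algebra F \<rightarrow>\<^sub>M prob_algebra (PiM I (\<lambda>_. F))"
proof (rule measurable_prob_algebra_generated[OF sets_PiM Int_stable_prod_algebra prod_algebra_sets_into_space])
  fix P assume "P \<in> space (prob_algebra F)"
  then have P: "prob_space P" "sets P = sets F" by (auto simp: space_prob_algebra)
  show "prob_space (PiM I (\<lambda>_. P))" using P by (intro prob_space_PiM)
  show "sets (PiM I (\<lambda>_. P)) = sets (PiM I (\<lambda>_. F))" using P by (intro sets_PiM_cong) auto
next
  \<comment> \<open>The generator consists of rectangles, on which the product measure is a finite
    product of evaluations \<open>emeasure P (B i)\<close>, each measurable in
    \<open>P\<close>.\<close>
  fix A assume "A \<in> prod_algebra I (\<lambda>_. F)"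
  then obtain B where B: "A = Pi\<^sub>E I B" "\<And>i. i \<in> I \<Longrightarrow> B i \<in> sets F"
    using assms by (auto simp: prod_algebra_eq_finite)
  have "emeasure (PiM I (\<lambda>_. P)) A = (\<Prod>i\<in>I. emeasure P (B i))" if "P \<in> space (prob_algebra F)" for P
  proof -
    have P: "prob_space P" "sets P = sets F" using that by (auto simp: space_prob_algebra)
    interpret product_sigma_finite "\<lambda>_. P"
      by (unfold product_sigma_finite_def) (use P in \<open>auto intro: prob_space_imp_sigma_finite\<close>)
    show ?thesis unfolding B(1) using B(2) P assms by (intro emeasure_PiM) auto
  qed
  moreover have "(\<lambda>P. \<Prod>i\<in>I. emeasure P (B i)) \<in> borel_measurable (prob_algebra F)"
    using B(2) unfolding prob_algebra_def
    by (intro borel_measurable_prod_ennreal measurable_restrict_space1 measurable_emeasure_subprob_algebra) auto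
  ultimately show "(\<lambda>P. emeasure (PiM I (\<lambda>_. P)) A) \<in> borel_measurable (prob_algebra F)"
    by (simp cong: measurable_cong)
qed

lemma
  assumes HP: "HP \<in> space (prob_algebra (prob_algebra F))"
  shows prob_space_frakP: "prob_space (frakP F n HP)"
    and sets_frakP: "sets (frakP F n HP) = sets (prob_algebra F \<Otimes>\<^sub>M PiM {..<n} (\<lambda>_. F))"
proof -
  note [measurable] = measurable_PiM_prob_algebra[of "{..<n}" F, OF finite_lessThan]
  have "(\<lambda>P. distr (PiM {..<n} (\<lambda>_. P)) (prob_algebra F \<Otimes>\<^sub>M PiM {..<n} (\<lambda>_. F)) (\<lambda>fs. (P, fs)))
      \<in> prob_algebra F \<rightarrow>\<^sub>M prob_algebra (prob_algebra F \<Otimes>\<^sub>M PiM {..<n} (\<lambda>_. F))"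
    by measurable
  from prob_space_bind'[OF HP this] sets_bind'[OF HP this]
  show "prob_space (frakP F n HP)"
    and "sets (frakP F n HP) = sets (prob_algebra F \<Otimes>\<^sub>M PiM {..<n} (\<lambda>_. F))"
    unfolding frakP_def .
qed

text \<open>The component law lets integrals of functions of a single predictor be computed under
  its own posterior \<open>Q i\<close>.\<close>

lemma
  assumes HQ: "HQ \<in> space (prob_algebra (prob_algebra F))"
    and Q: "\<And>i. i < n \<Longrightarrow> Q i \<in> space (prob_algebra F)"
  shows prob_space_frakQ: "prob_space (frakQ n HQ Q)"
    and sets_frakQ: "sets (frakQ n HQ Q) = sets (prob_algebra F \<Otimes>\<^sub>M PiM {..<n} (\<lambda>_. F))"
    and distr_frakQ_component: "i < n \<Longrightarrow> distr (frakQ n HQ Q) (Q i) (\<lambda>w. snd w i) = Q i"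
proof -
  have HQ': "prob_space HQ" "sets HQ = sets (prob_algebra F)" using HQ by (auto simp: space_prob_algebra)
  have Q': "prob_space (Q i)" "sets (Q i) = sets F" if "i < n" for i
    using Q[OF that] by (auto simp: space_prob_algebra)
  interpret HQ: prob_space HQ by fact
  interpret PQ: prob_space "PiM {..<n} Q" using Q' by (intro prob_space_PiM) auto
  interpret pair_prob_space HQ "PiM {..<n} Q" by unfold_locales
  show "prob_space (frakQ n HQ Q)" unfolding frakQ_def by unfold_locales
  show "sets (frakQ n HQ Q) = sets (prob_algebra F \<Otimes>\<^sub>M PiM {..<n} (\<lambda>_. F))"
    unfolding frakQ_def using HQ' Q' by (intro sets_pair_measure_cong sets_PiM_cong) auto
  assume i: "i < n"
  have [measurable]: "(\<lambda>fs. fs i) \<in> PiM {..<n} Q \<rightarrow>\<^sub>M Q i"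
    using i by (intro measurable_component_singleton) auto
  have snd: "distr (HQ \<Otimes>\<^sub>M PiM {..<n} Q) (PiM {..<n} Q) snd = PiM {..<n} Q"
  proof (rule measure_eqI)
    fix A assume "A \<in> sets (distr (HQ \<Otimes>\<^sub>M PiM {..<n} Q) (PiM {..<n} Q) snd)"
    then have A: "A \<in> sets (PiM {..<n} Q)" by simp
    have "snd -` A \<inter> space (HQ \<Otimes>\<^sub>M PiM {..<n} Q) = space HQ \<times> A"
      using sets.sets_into_space[OF A] by (auto simp: space_pair_measure)
    then show "emeasure (distr (HQ \<Otimes>\<^sub>M PiM {..<n} Q) (PiM {..<n} Q) snd) A = emeasure (PiM {..<n} Q) A"
      using A by (simp add: emeasure_distr PQ.emeasure_pair_measure_Times HQ.emeasure_space_1)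
  qed simp
  have "distr (HQ \<Otimes>\<^sub>M PiM {..<n} Q) (Q i) (\<lambda>w. snd w i)
      = distr (distr (HQ \<Otimes>\<^sub>M PiM {..<n} Q) (PiM {..<n} Q) snd) (Q i) (\<lambda>fs. fs i)"
    by (subst distr_distr) (auto simp: comp_def)
  also have "\<dots> = Q i" unfolding snd using i Q' by (intro distr_PiM_component) auto
  finally show "distr (frakQ n HQ Q) (Q i) (\<lambda>w. snd w i) = Q i" by (simp add: frakQ_def)
qed

theorem theorem5:
  fixes Z :: "'z measure" and F :: "'f measure"
    and n :: nat and m :: "nat \<Rightarrow> nat"
    and D :: "nat \<Rightarrow> 'z measure"
    and l :: "nat \<Rightarrow> 'f \<Rightarrow> 'z \<Rightarrow> real"
    and HP :: "'f measure measure"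
    and \<delta> :: real
  assumes n_pos: "n \<ge> 1"
    and m_pos: "\<And>i. i < n \<Longrightarrow> m i \<ge> 1"
    and D_prob: "\<And>i. i < n \<Longrightarrow> D i \<in> space (prob_algebra Z)"
    and l_meas: "\<And>i. i < n \<Longrightarrow> (\<lambda>(f, z). l i f z) \<in> borel_measurable (F \<Otimes>\<^sub>M Z)"
    and l_range: "\<And>i f z. i < n \<Longrightarrow> 0 \<le> l i f z \<and> l i f z \<le> 1"
    and HP_prob: "HP \<in> space (prob_algebra (prob_algebra F))"
    and delta_pos: "\<delta> > 0"
  shows "\<exists>E \<in> sets (sample_dist n m D).
           measure (sample_dist n m D) E \<ge> 1 - \<delta> \<and>
           (\<forall>S \<in> E. \<forall>HQ Q.
              HQ \<in> space (prob_algebra (prob_algebra F)) \<longrightarrow>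
              (\<forall>i<n. Q i \<in> space (prob_algebra F)) \<longrightarrow>
              (let M = (\<Sum>i<n. m i);
                   R = (\<Sum>i<n. real (m i) / real M * risk (l i) (D i) (Q i));
                   Rhat = (\<Sum>i<n. real (m i) / real M * emp_risk (l i) (m i) (S i) (Q i))
               in kl_bin Rhat R \<le>
                  (KLdiv (frakQ n HQ Q) (frakP F n HP) + ereal (ln (2 * sqrt (real M) / \<delta>)))
                    / ereal (real M)))"
proof -
  have D': "prob_space (D i)" "sets (D i) = sets Z" if "i < n" for i
    using D_prob[OF that] by (auto simp: space_prob_algebra)
  interpret P: prob_space "frakP F n HP" using HP_prob by (rule prob_space_frakP)
  note P_sets[measurable_cong] = sets_frakP[OF HP_prob, of n]
  have samples: "independent_samples n m D" using n_pos m_pos D'(1) by (rule independent_samples.intro)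
  \<comment> \<open>A point \<open>w\<close> is a pair of a prior and a tuple of predictors; task
    \<open>i\<close> reads coordinate \<open>i\<close> of the tuple.\<close>
  interpret random_losses n m D "frakP F n HP" "\<lambda>i w. l i (snd w i)"
  proof (intro random_losses.intro random_losses_axioms.intro samples P.prob_space_axioms)
    fix i assume i: "i < n"
    then have [measurable]: "(\<lambda>fs. fs i) \<in> PiM {..<n} (\<lambda>_. F) \<rightarrow>\<^sub>M F"
      by (intro measurable_component_singleton) auto
    note [measurable_cong] = D'(2)[OF i]
    have "(\<lambda>x. (snd (fst x) i, snd x)) \<in> frakP F n HP \<Otimes>\<^sub>M D i \<rightarrow>\<^sub>M F \<Otimes>\<^sub>M Z" by measurable
    from measurable_compose[OF this l_meas[OF i]]
    show "(\<lambda>(w, z). l i (snd w i) z) \<in> borel_measurable (frakP F n HP \<Otimes>\<^sub>M D i)"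
      by (simp add: split_beta')
  qed (rule l_range)
  have M0: "real M > 0" using M_pos by simp
  \<comment> \<open>Both risks are sums of functions of one coordinate each, so by linearity only
    the marginals of \<open>frakQ\<close> enter.\<close>
  have integrals: "(\<integral>w. emp w S \<partial>frakQ n HQ Q) = (\<Sum>i<n. real (m i) / real M * emp_risk (l i) (m i) (S i) (Q i))"
      "(\<integral>w. true_risk w \<partial>frakQ n HQ Q) = (\<Sum>i<n. real (m i) / real M * risk (l i) (D i) (Q i))"
    if S: "S \<in> space SD" and HQ: "HQ \<in> space (prob_algebra (prob_algebra F))"
      and Q: "\<forall>i<n. Q i \<in> space (prob_algebra F)" for S HQ Q
  proof -
    have Q': "prob_space (Q i)" "sets (Q i) = sets F" if "i < n" for i
      using Q that by (auto simp: space_prob_algebra)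
    interpret fQ: prob_space "frakQ n HQ Q" using HQ Q by (intro prob_space_frakQ) auto
    have fQ_sets[measurable_cong]: "sets (frakQ n HQ Q) = sets (prob_algebra F \<Otimes>\<^sub>M PiM {..<n} (\<lambda>_. F))"
      using HQ Q by (intro sets_frakQ) auto
    have marginal: "(\<integral>w. g (snd w i) \<partial>frakQ n HQ Q) = (\<integral>f. g f \<partial>Q i)"
      and marginal_int: "integrable (frakQ n HQ Q) (\<lambda>w. g (snd w i))"
      if i: "i < n" and g: "g \<in> borel_measurable F" and gr: "\<And>f. 0 \<le> g f \<and> g f \<le> 1" for i and g :: "'f \<Rightarrow> real"
    proof -
      have [measurable]: "(\<lambda>fs. fs i) \<in> PiM {..<n} (\<lambda>_. F) \<rightarrow>\<^sub>M F"
        using i by (intro measurable_component_singleton) auto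
      note [measurable] = g
      have "(\<lambda>w. snd w i) \<in> frakQ n HQ Q \<rightarrow>\<^sub>M F" by measurable
      then have comp: "(\<lambda>w. snd w i) \<in> frakQ n HQ Q \<rightarrow>\<^sub>M Q i"
        using Q'(2)[OF i] by (simp cong: measurable_cong_sets)
      have g_Q: "g \<in> borel_measurable (Q i)"
        using g Q'(2)[OF i] by (simp cong: measurable_cong_sets)
      have "(\<integral>f. g f \<partial>Q i) = (\<integral>f. g f \<partial>distr (frakQ n HQ Q) (Q i) (\<lambda>w. snd w i))"
        using HQ Q i by (subst distr_frakQ_component) auto
      also have "\<dots> = (\<integral>w. g (snd w i) \<partial>frakQ n HQ Q)" by (rule integral_distr[OF comp g_Q])
      finally show "(\<integral>w. g (snd w i) \<partial>frakQ n HQ Q) = (\<integral>f. g f \<partial>Q i)" ..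
      show "integrable (frakQ n HQ Q) (\<lambda>w. g (snd w i))"
        using gr by (intro fQ.integrable_const_bound[where B = 1]) auto
    qed
    have l_meas_f: "(\<lambda>f. l i f z) \<in> borel_measurable F" if "i < n" "z \<in> space Z" for i z
      using measurable_compose[OF measurable_Pair2'[OF that(2)] l_meas[OF that(1)]] by simp
    have S_space: "S i j \<in> space Z" if "i < n" "j < m i" for i j
      using measurable_space[OF measurable_sample[OF that] S] sets_eq_imp_space_eq[OF D'(2)[OF that(1)]] by simp
    have loss: "(\<integral>w. l i (snd w i) (S i j) \<partial>frakQ n HQ Q) = loss_Q (l i) (Q i) (S i j)"
      and loss_int: "integrable (frakQ n HQ Q) (\<lambda>w. l i (snd w i) (S i j))" if "i < n" "j < m i" for i j
      using marginal[OF that(1) l_meas_f[OF that(1) S_space[OF that]] l_range[OF that(1)]]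
        marginal_int[OF that(1) l_meas_f[OF that(1) S_space[OF that]] l_range[OF that(1)]]
      by (auto simp: loss_Q_def)
    have "(\<integral>w. emp w S \<partial>frakQ n HQ Q) = (\<Sum>i<n. \<Sum>j<m i. \<integral>w. l i (snd w i) (S i j) \<partial>frakQ n HQ Q) / real M"
      unfolding emp_def integral_divide_zero
      by (subst Bochner_Integration.integral_sum)
         (auto intro!: Bochner_Integration.integrable_sum loss_int Bochner_Integration.integral_sum
            sum.cong arg_cong[where f = "\<lambda>x. x / real M"])
    also have "\<dots> = (\<Sum>i<n. \<Sum>j<m i. loss_Q (l i) (Q i) (S i j)) / real M"
      using loss by simp
    also have "\<dots> = (\<Sum>i<n. real (m i) / real M * emp_risk (l i) (m i) (S i) (Q i))"
    proof (subst sum_divide_distrib, rule sum.cong)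
      fix i assume "i \<in> {..<n}"
      then have "m i > 0" using m_pos[of i] by simp
      then show "(\<Sum>j<m i. loss_Q (l i) (Q i) (S i j)) / real M
          = real (m i) / real M * emp_risk (l i) (m i) (S i) (Q i)"
        using M0 by (simp add: emp_risk_def)
    qed simp
    finally show "(\<integral>w. emp w S \<partial>frakQ n HQ Q) = (\<Sum>i<n. real (m i) / real M * emp_risk (l i) (m i) (S i) (Q i))" .

    have risk: "(\<integral>w. (\<integral>z. l i (snd w i) z \<partial>D i) \<partial>frakQ n HQ Q) = risk (l i) (D i) (Q i)"
      and risk_int: "integrable (frakQ n HQ Q) (\<lambda>w. \<integral>z. l i (snd w i) z \<partial>D i)" if i: "i < n" for i
    proof -
      interpret Di: prob_space "D i" using D' i by simp
      interpret Qi: prob_space "Q i" using Q' i by simp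
      interpret DQ: pair_prob_space "D i" "Q i" by unfold_locales
      note [measurable_cong] = D'(2)[OF i] Q'(2)[OF i]
      have FD[measurable]: "(\<lambda>(f, z). l i f z) \<in> borel_measurable (F \<Otimes>\<^sub>M D i)"
        using l_meas[OF i] by (simp cong: measurable_cong_sets)
      have g: "(\<lambda>f. \<integral>z. l i f z \<partial>D i) \<in> borel_measurable F"
        using FD by (rule Di.borel_measurable_lebesgue_integral)
      have gr: "0 \<le> (\<integral>z. l i f z \<partial>D i) \<and> (\<integral>z. l i f z \<partial>D i) \<le> 1" for f
      proof (cases "integrable (D i) (l i f)")
        case True
        then show ?thesis using l_range[OF i]
          by (auto intro!: Bochner_Integration.integral_nonneg Di.integral_le_const)
      qed (simp add: not_integrable_integral_eq)
      show "integrable (frakQ n HQ Q) (\<lambda>w. \<integral>z. l i (snd w i) z \<partial>D i)"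
        using i g gr by (rule marginal_int)
      \<comment> \<open>\<open>risk\<close> integrates over predictors first,
        \<open>true_risk\<close> over samples first; Fubini's theorem identifies them.\<close>
      have "integrable (D i \<Otimes>\<^sub>M Q i) (\<lambda>(z, f). l i f z)"
        using l_range[OF i] by (intro DQ.P.integrable_const_bound[where B = 1]) auto
      from DQ.Fubini_integral[OF this]
      have "(\<integral>f. (\<integral>z. l i f z \<partial>D i) \<partial>Q i) = risk (l i) (D i) (Q i)"
        by (simp add: risk_def loss_Q_def)
      then show "(\<integral>w. (\<integral>z. l i (snd w i) z \<partial>D i) \<partial>frakQ n HQ Q) = risk (l i) (D i) (Q i)"
        using marginal[OF i g gr] by simp
    qed
    show "(\<integral>w. true_risk w \<partial>frakQ n HQ Q) = (\<Sum>i<n. real (m i) / real M * risk (l i) (D i) (Q i))"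
      unfolding true_risk_def using risk risk_int
      by (simp add: Bochner_Integration.integral_sum)
  qed
  obtain E where E: "E \<in> sets SD" "measure SD E \<ge> 1 - \<delta>"
    and bound: "\<And>S Q. S \<in> E \<Longrightarrow> prob_space Q \<Longrightarrow> sets Q = sets (frakP F n HP) \<Longrightarrow>
       kl_bin (\<integral>w. emp w S \<partial>Q) (\<integral>w. true_risk w \<partial>Q)
         \<le> (KLdiv Q (frakP F n HP) + ereal (ln (2 * sqrt (real M) / \<delta>))) / ereal (real M)"
    using PAC_Bayes_kl[OF delta_pos] by blast
  show ?thesis
  proof (intro bexI[OF _ E(1)] conjI E(2) ballI allI impI)
    fix S HQ Q assume S: "S \<in> E" and HQ: "HQ \<in> space (prob_algebra (prob_algebra F))"
      and Q: "\<forall>i<n. Q i \<in> space (prob_algebra F)"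
    have "prob_space (frakQ n HQ Q)" "sets (frakQ n HQ Q) = sets (frakP F n HP)"
      using prob_space_frakQ[OF HQ] sets_frakQ[OF HQ] Q P_sets by auto
    from bound[OF S this] integrals[OF _ HQ Q, of S] sets.sets_into_space[OF E(1)] S
    show "let M = (\<Sum>i<n. m i);
                   R = (\<Sum>i<n. real (m i) / real M * risk (l i) (D i) (Q i));
                   Rhat = (\<Sum>i<n. real (m i) / real M * emp_risk (l i) (m i) (S i) (Q i))
               in kl_bin Rhat R \<le>
                  (KLdiv (frakQ n HQ Q) (frakP F n HP) + ereal (ln (2 * sqrt (real M) / \<delta>)))
                    / ereal (real M)"
      unfolding Let_def M_def[symmetric] by auto
  qed
qed

end
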